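(* Let $\mathcal{H}$ be a $d$-dimensional complex Hilbert space, let $\mathbb{B}=\{\mathcal{B}_1,\ldots,\mathcal{B}_M\}$ be a set of $M\ge 1$ mutually unbiased bases in $\mathcal{H}$, let $\alpha\in(0,2]$, and let $\rho$ be an arbitrary density matrix on $\mathcal{H}$. Then the Tsallis entropies satisfy the state-dependent bound $$\frac{1}{M}\sum_{\mathcal{B}\in\mathbb{B}}H_\alpha(\mathcal{B}|\rho)\;\ge\;\ln_\alpha\!\left(\frac{Md}{\mathrm{tr}(\rho^2)\,d+M-1}\right),$$ and the state-independent bound $$\frac{1}{M}\sum_{\mathcal{B}\in\mathbb{B}}H_\alpha(\mathcal{B}|\rho)\;\ge\;\ln_\alpha\!\left(\frac{Md}{d+M-1}\right).$$
   Context: A density matrix on $\mathcal{H}$ is a positive semidefinite operator of trace $1$. Orthonormal bases $\{|b_j\rangle\}$ and $\{|c_k\rangle\}$ of $\mathcal{H}$ are mutually unbiased if $|\langle b_j|c_k\rangle|=1/\sqrt d$ for all $j,k$; a set of bases is a set of mutually unbiased bases (MUBs) if any two different bases in it are mutually unbiased. For $x>0$ and $\alpha>0$, $\alpha\ne1$, $\ln_\alpha(x)=\frac{x^{1-\alpha}-1}{1-\alpha}$, and $\ln_1(x)=\ln x$. For a probability distribution $p=\{p_j\}$, the Tsallis $\alpha$-entropy is $H_\alpha(p)=\frac{1}{1-\alpha}\bigl(\sum_j p_j^\alpha-1\bigr)$ for $\alpha>0$, $\alpha\neq 1$, and $H_1(p)=-\sum_j p_j\ln p_j$ (Shannon entropy,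 with $0\ln 0=0$). For an orthonormal basis $\mathcal{B}=\{|b_j\rangle\}_{j=1}^d$, $H_\alpha(\mathcal{B}|\rho)$ denotes $H_\alpha$ of the distribution $p_j(\mathcal{B}|\rho)=\langle b_j|\rho|b_j\rangle$. *)

theory Defs
  imports "HOL-Analysis.Analysis"
begin

(* The inner product is conjugate-linear in its first argument, as in the bra-ket notation. *)
class complex_inner = ab_group_add +
  fixes scaleC :: "complex \<Rightarrow> 'a \<Rightarrow> 'a"  (infixr \<open>*\<^sub>C\<close> 75)
    and cinner :: "'a \<Rightarrow> 'a \<Rightarrow> complex"
  assumes scaleC_add_right: "c *\<^sub>C (x + y) = c *\<^sub>C x + c *\<^sub>C y"
    and scaleC_add_left: "(c + c') *\<^sub>C x = c *\<^sub>C x + c' *\<^sub>C x"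
    and scaleC_scaleC: "c *\<^sub>C c' *\<^sub>C x = (c * c') *\<^sub>C x"
    and scaleC_one: "1 *\<^sub>C x = x"
    and cinner_commute: "cinner x y = cnj (cinner y x)"
    and cinner_add_right: "cinner x (y + z) = cinner x y + cinner x z"
    and cinner_scaleC_right: "cinner x (c *\<^sub>C y) = c * cinner x y"
    and cinner_ge_zero: "cinner x x \<in> \<real>\<^sub>\<ge>\<^sub>0"
    and cinner_eq_zero_iff: "cinner x x = 0 \<longleftrightarrow> x = 0"

(* No completeness axiom is needed: in finite dimension it is automatic. *)
class fin_dim_hilbert = complex_inner +
  assumes finitely_generated: "\<exists>S. finite S \<and> (\<forall>x. \<exists>u. x = (\<Sum>v\<in>S. u v *\<^sub>C v))"

global_interpretation complex_vector: vector_space "scaleC :: complex \<Rightarrow> 'a \<Rightarrow> 'a::complex_inner"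
  by unfold_locales (simp_all add: scaleC_add_right scaleC_add_left scaleC_scaleC scaleC_one)

definition orthonormal_basis :: "'a::fin_dim_hilbert set \<Rightarrow> bool" where
  "orthonormal_basis B \<longleftrightarrow>
     (\<forall>b\<in>B. \<forall>c\<in>B. cinner b c = (if b = c then 1 else 0)) \<and> complex_vector.span B = UNIV"

definition mutually_unbiased :: "'a::fin_dim_hilbert set \<Rightarrow> 'a set \<Rightarrow> bool" where
  "mutually_unbiased B C \<longleftrightarrow>
     (\<forall>b\<in>B. \<forall>c\<in>C. cmod (cinner b c) = 1 / sqrt (real (complex_vector.dim (UNIV :: 'a set))))"

definition MUBs :: "'a::fin_dim_hilbert set set \<Rightarrow> bool" where
  "MUBs \<BB> \<longleftrightarrow> (\<forall>B\<in>\<BB>. orthonormal_basis B) \<and>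
     (\<forall>B\<in>\<BB>. \<forall>C\<in>\<BB>. B \<noteq> C \<longrightarrow> mutually_unbiased B C)"

(* Independent of the chosen basis; see the lemma trace_op_eq below. *)
definition trace_op :: "('a::fin_dim_hilbert \<Rightarrow> 'a) \<Rightarrow> complex" where
  "trace_op A = (\<Sum>b\<in>(SOME B. orthonormal_basis B). cinner b (A b))"

(* Over the complex numbers the condition on cinner x (A x) makes A self-adjoint. *)
definition positive_semidefinite :: "('a::fin_dim_hilbert \<Rightarrow> 'a) \<Rightarrow> bool" where
  "positive_semidefinite A \<longleftrightarrow>
     Vector_Spaces.linear scaleC scaleC A \<and> (\<forall>x. cinner x (A x) \<in> \<real>\<^sub>\<ge>\<^sub>0)"

definition density_matrix :: "('a::fin_dim_hilbert \<Rightarrow> 'a) \<Rightarrow> bool" where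
  "density_matrix \<rho> \<longleftrightarrow> positive_semidefinite \<rho> \<and> trace_op \<rho> = 1"

definition ln_tsallis :: "real \<Rightarrow> real \<Rightarrow> real" where
  "ln_tsallis \<alpha> x = (if \<alpha> = 1 then ln x else (x powr (1 - \<alpha>) - 1) / (1 - \<alpha>))"

(* A distribution is a function p on a finite index set I.  As 0 powr a = 0 and 0 * ln 0 = 0
   in HOL, outcomes of probability 0 contribute nothing. *)
definition tsallis_entropy :: "real \<Rightarrow> 'i set \<Rightarrow> ('i \<Rightarrow> real) \<Rightarrow> real" where
  "tsallis_entropy \<alpha> I p =
     (if \<alpha> = 1 then - (\<Sum>i\<in>I. p i * ln (p i))
      else 1 / (1 - \<alpha>) * ((\<Sum>i\<in>I. p i powr \<alpha>) - 1))"

(* The outcomes of a measurement in the basis B are indexed by the basis vectors themselves. *)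
definition basis_entropy :: "real \<Rightarrow> 'a::fin_dim_hilbert set \<Rightarrow> ('a \<Rightarrow> 'a) \<Rightarrow> real" where
  "basis_entropy \<alpha> B \<rho> = tsallis_entropy \<alpha> B (\<lambda>b. Re (cinner b (\<rho> b)))"

lemma cinner_zero_right [simp]: "cinner x (0::'a::complex_inner) = 0"
  using cinner_add_right[of x 0 0] by simp

lemma cinner_sum_right: "cinner (x::'a::complex_inner) (\<Sum>i\<in>I. f i) = (\<Sum>i\<in>I. cinner x (f i))"
  by (induction I rule: infinite_finite_induct) (simp_all add: cinner_add_right)

lemma cinner_add_left: "cinner (x + y) (z::'a::complex_inner) = cinner x z + cinner y z"
  by (metis cinner_add_right cinner_commute complex_cnj_add)

lemma cinner_zero_left [simp]: "cinner (0::'a::complex_inner) x = 0"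
  by (metis cinner_commute cinner_zero_right complex_cnj_zero)

lemma cinner_sum_left: "cinner (\<Sum>i\<in>I. f i) (x::'a::complex_inner) = (\<Sum>i\<in>I. cinner (f i) x)"
  by (induction I rule: infinite_finite_induct) (simp_all add: cinner_add_left)

lemma cinner_scaleC_left: "cinner (c *\<^sub>C x) (y::'a::complex_inner) = cnj c * cinner x y"
  by (metis cinner_commute cinner_scaleC_right complex_cnj_mult)

lemma orthonormal_expansion:
  fixes x :: "'a::complex_inner"
  assumes fin: "finite B" and on: "\<forall>b\<in>B. \<forall>c\<in>B. cinner b c = (if b = c then 1 else 0)"
    and x: "x \<in> complex_vector.span B"
  shows "x = (\<Sum>b\<in>B. cinner b x *\<^sub>C b)"
proof -
  obtain u where u: "x = (\<Sum>b\<in>B. u b *\<^sub>C b)"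
    using x complex_vector.span_finite[OF fin] by auto
  have "cinner c x = u c" if "c \<in> B" for c
  proof -
    have "cinner c x = (\<Sum>b\<in>B. u b * cinner c b)"
      by (simp add: u cinner_sum_right cinner_scaleC_right)
    also have "\<dots> = (\<Sum>b\<in>B. if c = b then u b else 0)"
      using on that by (intro sum.cong) auto
    finally show ?thesis
      using fin that by simp
  qed
  then show ?thesis
    using u by (auto intro: sum.cong)
qed

lemma finite_spanning_set: "\<exists>S :: 'a::fin_dim_hilbert set. finite S \<and> complex_vector.span S = UNIV"
proof -
  obtain S :: "'a set" where "finite S" "\<forall>x. \<exists>u. x = (\<Sum>v\<in>S. u v *\<^sub>C v)"
    using finitely_generated by blast
  then show ?thesis
    by (intro exI[of _ S]) (auto simp: complex_vector.span_finite)
qed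

lemma orthonormal_basis_finite_card:
  fixes B :: "'a::fin_dim_hilbert set"
  assumes "orthonormal_basis B"
  shows "finite B" "card B = complex_vector.dim (UNIV :: 'a set)"
proof -
  have on: "\<forall>b\<in>B. \<forall>c\<in>B. cinner b c = (if b = c then 1 else 0)"
    and span: "complex_vector.span B = UNIV"
    using assms by (auto simp: orthonormal_basis_def)
  have ind: "complex_vector.independent B"
  proof
    assume "complex_vector.dependent B"
    then obtain S u v where S: "finite S" "S \<subseteq> B" "(\<Sum>w\<in>S. u w *\<^sub>C w) = 0" "v \<in> S" "u v \<noteq> 0"
      unfolding complex_vector.dependent_explicit by blast
    have "0 = cinner v (\<Sum>w\<in>S. u w *\<^sub>C w)"
      using S by simp
    also have "\<dots> = (\<Sum>w\<in>S. u w * cinner v w)"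
      by (simp only: cinner_sum_right cinner_scaleC_right)
    also have "\<dots> = (\<Sum>w\<in>S. if v = w then u w else 0)"
    proof (rule sum.cong)
      fix w assume "w \<in> S"
      then have "cinner v w = (if v = w then 1 else 0)"
        using on S by blast
      then show "u w * cinner v w = (if v = w then u w else 0)"
        by simp
    qed simp
    also have "\<dots> = u v"
      using S by simp
    finally show False
      using S by simp
  qed
  obtain S :: "'a set" where "finite S" "complex_vector.span S = UNIV"
    using finite_spanning_set by blast
  then show "finite B"
    using complex_vector.independent_span_bound[OF _ ind] by blast
  show "card B = complex_vector.dim (UNIV :: 'a set)"
    using complex_vector.dim_eq_card[of B UNIV] ind span by simp
qed

lemma trace_op_eq:
  fixes A :: "'a::fin_dim_hilbert \<Rightarrow> 'a"
  assumes lin: "Vector_Spaces.linear scaleC scaleC A" and B: "orthonormal_basis B"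
  shows "trace_op A = (\<Sum>b\<in>B. cinner b (A b))"
proof -
  define C :: "'a set" where "C = (SOME B. orthonormal_basis B)"
  have C: "orthonormal_basis C"
    using someI[of orthonormal_basis B] B by (simp add: C_def)
  note finB = orthonormal_basis_finite_card(1)[OF B] and finC = orthonormal_basis_finite_card(1)[OF C]
  have expand: "x = (\<Sum>b\<in>D. cinner b x *\<^sub>C b)" if "orthonormal_basis D" for D and x :: 'a
    using that orthonormal_basis_finite_card(1)[OF that] orthonormal_expansion[of D x]
    by (auto simp: orthonormal_basis_def)
  interpret A: Vector_Spaces.linear scaleC scaleC A by (rule lin)
  have "trace_op A = (\<Sum>c\<in>C. cinner c (A c))"
    by (simp add: trace_op_def C_def)
  also have "\<dots> = (\<Sum>c\<in>C. \<Sum>b\<in>B. cinner b c * cinner c (A b))"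
  proof (rule sum.cong)
    fix c
    have "A c = A (\<Sum>b\<in>B. cinner b c *\<^sub>C b)"
      using expand[OF B, of c] by simp
    then show "cinner c (A c) = (\<Sum>b\<in>B. cinner b c * cinner c (A b))"
      by (simp add: A.sum A.scale cinner_sum_right cinner_scaleC_right)
  qed simp
  also have "\<dots> = (\<Sum>b\<in>B. \<Sum>c\<in>C. cinner c (A b) * cinner b c)"
    by (subst sum.swap) (simp add: mult.commute)
  also have "\<dots> = (\<Sum>b\<in>B. cinner b (A b))"
  proof (rule sum.cong)
    fix b
    have "cinner b (A b) = cinner b (\<Sum>c\<in>C. cinner c (A b) *\<^sub>C c)"
      using expand[OF C, of "A b"] by simp
    then show "(\<Sum>c\<in>C. cinner c (A b) * cinner b c) = cinner b (A b)"
      by (simp add: cinner_sum_right cinner_scaleC_right)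
  qed simp
  finally show ?thesis .
qed

(* The coordinate spaces complex ^ 'n are instances of the class. *)
instantiation complex :: fin_dim_hilbert
begin
definition "scaleC c x = c * (x::complex)"
definition "cinner x y = cnj x * (y::complex)"
instance
proof (intro_classes, unfold scaleC_complex_def cinner_complex_def)
  fix x :: complex
  show "cnj x * x \<in> \<real>\<^sub>\<ge>\<^sub>0"
    by (metis complex_norm_square mult.commute nonneg_Reals_of_real_iff zero_le_power2)
  show "\<exists>S. finite S \<and> (\<forall>x::complex. \<exists>u. x = (\<Sum>v\<in>S. u v * v))"
    by (intro exI[of _ "{1}"]) auto
qed (simp_all add: algebra_simps)
end

instantiation vec :: (complex_inner, finite) complex_inner
begin
definition "scaleC c x = (\<chi> i. c *\<^sub>C (x $ i))"
definition "cinner x y = (\<Sum>i\<in>UNIV. cinner (x $ i) (y $ i))"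
instance
proof
  fix x :: "'a^'b"
  have nonneg: "0 \<le> Re (cinner y y)" and real: "cinner y y = of_real (Re (cinner y y))" for y :: 'a
    using cinner_ge_zero[of y] by (auto simp: complex_nonneg_Reals_iff complex_eq_iff)
  have eq: "cinner x x = of_real (\<Sum>i\<in>UNIV. Re (cinner (x $ i) (x $ i)))"
    unfolding cinner_vec_def of_real_sum using real by (intro sum.cong) auto
  show "cinner x x \<in> \<real>\<^sub>\<ge>\<^sub>0"
    unfolding eq nonneg_Reals_of_real_iff by (intro sum_nonneg nonneg)
  have "Re (cinner y y) = 0 \<longleftrightarrow> y = 0" for y :: 'a
    using cinner_eq_zero_iff[of y] real[of y] by (metis of_real_0 zero_complex.simps(1))
  then show "cinner x x = 0 \<longleftrightarrow> x = 0"
    unfolding eq of_real_eq_0_iff by (simp add: sum_nonneg_eq_0_iff nonneg vec_eq_iff)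
next
  fix x y :: "'a^'b"
  show "cinner x y = cnj (cinner y x)"
    unfolding cinner_vec_def cnj_sum by (intro sum.cong refl cinner_commute)
qed (simp_all add: scaleC_vec_def cinner_vec_def vec_eq_iff scaleC_add_right scaleC_add_left
       scaleC_scaleC scaleC_one cinner_add_right cinner_scaleC_right sum.distrib sum_distrib_left)
end

instance vec :: (fin_dim_hilbert, finite) fin_dim_hilbert
proof
  obtain S :: "'a set" where S: "finite S" "complex_vector.span S = UNIV"
    using finite_spanning_set by blast
  define T :: "('a^'b) set" where "T = (\<Union>i. axis i ` S)"
  have lin: "Vector_Spaces.linear scaleC scaleC (axis i :: 'a \<Rightarrow> 'a^'b)" for i
    by unfold_locales (simp_all add: axis_def scaleC_vec_def vec_eq_iff)
  have ax: "axis i y \<in> complex_vector.span T" for i y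
  proof -
    have "axis i y \<in> axis i ` complex_vector.span S"
      using S by auto
    also have "\<dots> = complex_vector.span (axis i ` S)"
      using module_hom.span_image lin[of i] by (metis Vector_Spaces.linear.axioms(3))
    also have "\<dots> \<subseteq> complex_vector.span T"
      by (intro complex_vector.span_mono) (auto simp: T_def)
    finally show ?thesis .
  qed
  have "x \<in> complex_vector.span T" for x
  proof -
    have "x = (\<Sum>i\<in>UNIV. axis i (x $ i))"
      by (simp add: vec_eq_iff axis_def)
    then show ?thesis
      using ax by (metis complex_vector.span_sum)
  qed
  moreover have "finite T"
    using S by (simp add: T_def)
  ultimately show "\<exists>T :: ('a^'b) set. finite T \<and> (\<forall>x. \<exists>u. x = (\<Sum>v\<in>T. u v *\<^sub>C v))"
    by (intro exI[of _ T]) (auto simp: complex_vector.span_finite)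
qed

end

theory Submission
  imports Defs
begin

text \<open>The Tsallis entropy is the mean of \<open>ln\<^sub>\<alpha> (1 / p\<^sub>j)\<close> under \<open>p\<close> itself, and
  \<open>x \<mapsto> ln\<^sub>\<alpha> (1 / x)\<close> is decreasing and, for \<open>\<alpha> \<le> 2\<close>, convex. By Jensen's inequality, in the
  form of a tangent line bound, the average entropy is at least the value of this function at the
  averaged collision probability, the mean over the bases of \<open>\<Sum>\<^sub>j p\<^sub>j\<^sup>2\<close>.
  For mutually unbiased bases the latter is at most \<open>(tr \<rho>\<^sup>2 + (M - 1) / d) / M\<close>, by Bessel's inequality in
  Hilbert--Schmidt space. The state-independent bound follows from \<open>tr \<rho>\<^sup>2 \<le> 1\<close>.\<close>

section \<open>Tangent lines to \<open>ln_tsallis\<close> and lower bounds for the entropy\<close>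

lemma Bernoulli_powr_le:
  fixes s b :: real
  assumes "0 < s" "0 \<le> b" "b \<le> 1"
  shows "s powr b \<le> 1 + b * (s - 1)"
  \<comment> \<open>Weighted AM-GM for \<open>s\<close> and 1 with weights \<open>b\<close> and
    \<open>1 - b\<close>.\<close>
  using Youngs_inequality_0[of b "1 - b" s 1] assms by (simp add: algebra_simps)

text \<open>Combines \<open>s powr b = exp (b * ln s)\<close>, exp u \<ge> 1 + u and ln s \<le> s -
  1, the last reversed by \<open>b \<le> 0\<close>.\<close>

lemma Bernoulli_powr_ge:
  fixes s b :: real
  assumes "0 < s" "b \<le> 0"
  shows "1 + b * (s - 1) \<le> s powr b"
proof -
  have "1 + b * (s - 1) \<le> 1 + b * ln s"
    using assms ln_le_minus_one[of s] by (simp add: mult_left_mono_neg)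
  also have "\<dots> \<le> s powr b"
    using assms exp_ge_add_one_self[of "b * ln s"] by (simp add: powr_def)
  finally show ?thesis .
qed

text \<open>For b = \<alpha> - 1 nonzero the function is x \<mapsto> (1 - x^b) / b, with slope
  -y^(b-1) at y. Scaling by y^b reduces the claim to a Bernoulli inequality in x / y; \<alpha> \<le>
  2 supplies b \<le> 1.\<close>

lemma ln_tsallis_inverse_tangent:
  assumes "\<alpha> \<le> 2" "0 < x" "0 < y"
  shows "ln_tsallis \<alpha> (1 / y) - y powr (\<alpha> - 2) * (x - y) \<le> ln_tsallis \<alpha> (1 / x)"
proof (cases "\<alpha> = 1")
  case True
  have "ln (x / y) \<le> x / y - 1"
    using assms by (intro ln_le_minus_one) simp
  then show ?thesis
    using True assms by (simp add: ln_tsallis_def ln_div powr_minus_divide diff_divide_distrib)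
next
  case False
  define b where "b = \<alpha> - 1"
  have b: "b \<noteq> 0" "b \<le> 1"
    using False assms by (auto simp: b_def)
  have inv: "(1 / z) powr (- b) = z powr b" if "0 < z" for z :: real
    using that by (simp add: powr_divide powr_minus_divide)
  \<comment> \<open>The two Bernoulli inequalities point in opposite directions, and dividing by
    \<open>b\<close> of either sign brings them to one form.\<close>
  have "((x / y) powr b - 1) / b \<le> x / y - 1"
  proof (cases "b > 0")
    case True
    then show ?thesis
      using Bernoulli_powr_le[of "x / y" b] assms b by (simp add: pos_divide_le_eq mult.commute)
  next
    case neg: False
    then show ?thesis
      using Bernoulli_powr_ge[of "x / y" b] assms b by (simp add: neg_divide_le_eq mult.commute)
  qed
  then have "y powr b * (((x / y) powr b - 1) / b) \<le> y powr b * (x / y - 1)"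
    by (intro mult_left_mono) auto
  moreover have "y powr b * (((x / y) powr b - 1) / b) = (x powr b - y powr b) / b"
  proof -
    have "y powr b * ((x / y) powr b - 1) = x powr b - y powr b"
      using assms by (simp add: powr_divide right_diff_distrib)
    then show ?thesis
      by (metis times_divide_eq_right)
  qed
  moreover have "y powr b * (x / y - 1) = y powr (b - 1) * (x - y)"
    using assms by (simp add: powr_diff field_simps)
  ultimately have "(x powr b - y powr b) / b \<le> y powr (b - 1) * (x - y)"
    by metis
  moreover have "\<alpha> = b + 1"
    by (simp add: b_def)
  ultimately show ?thesis
    using assms False inv b by (simp add: ln_tsallis_def diff_divide_distrib)
qed

lemma tsallis_entropy_eq_sum_ln_tsallis:
  assumes "0 < \<alpha>" and p: "\<And>i. 0 \<le> p i" and sum: "(\<Sum>i\<in>I. p i) = 1"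
  shows "tsallis_entropy \<alpha> I p = (\<Sum>i\<in>I. p i * ln_tsallis \<alpha> (1 / p i))"
proof (cases "\<alpha> = 1")
  case True
  have "p i * ln (1 / p i) = - (p i * ln (p i))" for i
    using p[of i] by (cases "p i = 0") (auto simp: ln_div)
  then show ?thesis
    using True by (simp add: tsallis_entropy_def ln_tsallis_def sum_negf)
next
  case False
  have "p i * ((1 / p i) powr (1 - \<alpha>) - 1) = p i powr \<alpha> - p i" for i
  proof (cases "p i = 0")
    case False
    then have "0 < p i"
      using p[of i] by simp
    then show ?thesis
      by (simp add: powr_divide powr_diff field_simps)
  qed (use assms in simp)
  then have "(\<Sum>i\<in>I. p i * ln_tsallis \<alpha> (1 / p i)) = (\<Sum>i\<in>I. (p i powr \<alpha> - p i) / (1 - \<alpha>))"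
    using False by (simp add: ln_tsallis_def)
  also have "\<dots> = ((\<Sum>i\<in>I. p i powr \<alpha>) - 1) / (1 - \<alpha>)"
    using sum by (simp add: sum_subtractf flip: sum_divide_distrib)
  finally show ?thesis
    using False by (simp add: tsallis_entropy_def)
qed

text \<open>The tangent bound at \<open>x = p i\<close>, averaged with the weights
  \<open>p i\<close>. The point \<open>y\<close> stays free so that several distributions can share
  it.\<close>

lemma tsallis_entropy_ge:
  assumes "0 < \<alpha>" "\<alpha> \<le> 2" "0 < y" and p: "\<And>i. 0 \<le> p i" and sum: "(\<Sum>i\<in>I. p i) = 1"
  shows "ln_tsallis \<alpha> (1 / y) - y powr (\<alpha> - 2) * ((\<Sum>i\<in>I. (p i)\<^sup>2) - y) \<le> tsallis_entropy \<alpha> I p"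
proof -
  \<comment> \<open>The tangent bound covers only \<open>p i > 0\<close>; otherwise the factor
    \<open>p i\<close> annihilates both sides.\<close>
  have "p i * (ln_tsallis \<alpha> (1 / y) - y powr (\<alpha> - 2) * (p i - y)) \<le> p i * ln_tsallis \<alpha> (1 / p i)" for i
    using ln_tsallis_inverse_tangent[of \<alpha> "p i" y] assms p[of i]
    by (cases "p i = 0") (auto intro: mult_left_mono)
  then have "(\<Sum>i\<in>I. p i * (ln_tsallis \<alpha> (1 / y) - y powr (\<alpha> - 2) * (p i - y))) \<le> tsallis_entropy \<alpha> I p"
    unfolding tsallis_entropy_eq_sum_ln_tsallis[OF \<open>0 < \<alpha>\<close> p sum] by (intro sum_mono)
  moreover have "(\<Sum>i\<in>I. p i * (ln_tsallis \<alpha> (1 / y) - y powr (\<alpha> - 2) * (p i - y)))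
      = (\<Sum>i\<in>I. p i) * ln_tsallis \<alpha> (1 / y)
        - y powr (\<alpha> - 2) * ((\<Sum>i\<in>I. (p i)\<^sup>2) - (\<Sum>i\<in>I. p i) * y)"
    by (simp add: sum_distrib_left sum_distrib_right algebra_simps power2_eq_square
        sum.distrib sum_subtractf)
  ultimately show ?thesis
    using sum by simp
qed

text \<open>With a common tangent point all slopes agree, so only the total collision probability
  matters, and the correction term has the right sign. A single \<open>p\<close> suffices because
  outcomes will be the basis vectors themselves.\<close>

lemma sum_tsallis_entropy_ge:
  fixes y :: real
  assumes "0 < \<alpha>" "\<alpha> \<le> 2" "0 < y" and p: "\<And>i. 0 \<le> p i"
    and sum: "\<And>I. I \<in> \<I> \<Longrightarrow> (\<Sum>i\<in>I. p i) = 1"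
    and le: "(\<Sum>I\<in>\<I>. \<Sum>i\<in>I. (p i)\<^sup>2) \<le> card \<I> * y"
  shows "card \<I> * ln_tsallis \<alpha> (1 / y) \<le> (\<Sum>I\<in>\<I>. tsallis_entropy \<alpha> I p)"
proof -
  have "y powr (\<alpha> - 2) * (\<Sum>I\<in>\<I>. (\<Sum>i\<in>I. (p i)\<^sup>2) - y) \<le> 0"
    using le by (intro mult_nonneg_nonpos) (auto simp: sum_subtractf)
  then have "card \<I> * ln_tsallis \<alpha> (1 / y)
      \<le> (\<Sum>I\<in>\<I>. ln_tsallis \<alpha> (1 / y) - y powr (\<alpha> - 2) * ((\<Sum>i\<in>I. (p i)\<^sup>2) - y))"
    by (simp add: sum_subtractf flip: sum_distrib_left)
  also have "\<dots> \<le> (\<Sum>I\<in>\<I>. tsallis_entropy \<alpha> I p)"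
    using assms by (intro sum_mono tsallis_entropy_ge) auto
  finally show ?thesis .
qed

section \<open>Orthonormal expansions and positive semidefinite operators\<close>

lemma cinner_diff_right: "cinner x (y - z) = cinner x y - cinner x (z::'a::complex_inner)"
  using cinner_add_right[of x "y - z" z] by simp

lemma cinner_diff_left: "cinner (x - y) z = cinner x z - cinner y (z::'a::complex_inner)"
  using cinner_add_left[of "x - y" y z] by simp

lemma Re_cinner_ge_0: "0 \<le> Re (cinner x (x::'a::complex_inner))"
  using cinner_ge_zero[of x] by (simp add: complex_nonneg_Reals_iff)

lemma Re_cinner_commute: "Re (cinner x y) = Re (cinner y (x::'a::complex_inner))"
  by (subst cinner_commute) simp

lemma onb_expansion:
  fixes x :: "'a::fin_dim_hilbert"
  assumes "orthonormal_basis E"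
  shows "x = (\<Sum>e\<in>E. cinner e x *\<^sub>C e)"
  using assms orthonormal_basis_finite_card(1)[OF assms] orthonormal_expansion[of E x]
  by (auto simp: orthonormal_basis_def)

text \<open>Resolution of the identity, the sum of |e><e|, inserted between \<open>A\<close> and
  \<open>x\<close>.\<close>

lemma onb_cinner_linear:
  fixes A :: "'a::fin_dim_hilbert \<Rightarrow> 'a"
  assumes "orthonormal_basis E" and lin: "Vector_Spaces.linear scaleC scaleC A"
  shows "(\<Sum>e\<in>E. cinner e x * cinner y (A e)) = cinner y (A x)"
proof -
  interpret A: Vector_Spaces.linear scaleC scaleC A by (rule lin)
  have "A x = A (\<Sum>e\<in>E. cinner e x *\<^sub>C e)"
    using onb_expansion[OF assms(1), of x] by simp
  then show ?thesis
    by (simp add: A.sum A.scale cinner_sum_right cinner_scaleC_right)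
qed

lemma psd_Re_ge_0: "positive_semidefinite A \<Longrightarrow> 0 \<le> Re (cinner x (A x))"
  and psd_Im_eq_0: "positive_semidefinite A \<Longrightarrow> Im (cinner x (A x)) = 0"
  by (auto simp: positive_semidefinite_def complex_nonneg_Reals_iff)

text \<open>Polarization: the quadratic form is real at x + y and at x + iy, which fixes the
  imaginary and real parts respectively.\<close>

lemma psd_hermitian:
  assumes A: "positive_semidefinite A"
  shows "cinner (A x) y = cinner x (A y)"
proof -
  interpret A: Vector_Spaces.linear scaleC scaleC A
    using A by (simp add: positive_semidefinite_def)
  note expand = A.add A.scale cinner_add_left cinner_add_right cinner_scaleC_left cinner_scaleC_right
  have "Im (cinner (x + y) (A (x + y))) = 0" "Im (cinner (x + \<i> *\<^sub>C y) (A (x + \<i> *\<^sub>C y))) = 0"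
    using psd_Im_eq_0[OF A] by blast+
  then have "cinner x (A y) = cnj (cinner y (A x))"
    using psd_Im_eq_0[OF A, of x] psd_Im_eq_0[OF A, of y]
    by (simp add: expand complex_eq_iff)
  then show ?thesis
    by (metis cinner_commute)
qed

text \<open>The form <x|Ay> may be degenerate, so the usual quadratic argument treats q = 0
  separately.\<close>

lemma psd_Cauchy_Schwarz:
  assumes A: "positive_semidefinite A"
  shows "(cmod (cinner x (A y)))\<^sup>2 \<le> Re (cinner x (A x)) * Re (cinner y (A y))"
proof -
  interpret A: Vector_Spaces.linear scaleC scaleC A
    using A by (simp add: positive_semidefinite_def)
  note expand = A.add A.scale cinner_add_left cinner_add_right cinner_scaleC_left cinner_scaleC_right
  define a p q where "a = cinner x (A y)" and "p = Re (cinner x (A x))" and "q = Re (cinner y (A y))"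
  have yx: "cinner y (A x) = cnj a"
    using psd_hermitian[OF A, of x y] by (metis a_def cinner_commute)
  have xx: "cinner x (A x) = of_real p" and yy: "cinner y (A y) = of_real q"
    using psd_Im_eq_0[OF A] by (simp_all add: p_def q_def complex_eq_iff)
  have quad: "0 \<le> p - 2 * t * (cmod a)\<^sup>2 + t\<^sup>2 * (cmod a)\<^sup>2 * q" for t :: real
  proof -
    \<comment> \<open>This phase makes both cross terms equal to the real number -t |a|^2.\<close>
    define c where "c = - of_real t * cnj a"
    have "0 \<le> Re (cinner (x + c *\<^sub>C y) (A (x + c *\<^sub>C y)))"
      by (rule psd_Re_ge_0[OF A])
    also have "\<dots> = p - 2 * t * (cmod a)\<^sup>2 + t\<^sup>2 * (cmod a)\<^sup>2 * q"
      unfolding expand xx yy yx a_def[symmetric]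
      by (simp add: c_def cmod_power2) (simp add: power2_eq_square algebra_simps)
    finally show ?thesis .
  qed
  have "0 \<le> q"
    unfolding q_def by (rule psd_Re_ge_0[OF A])
  then consider "q = 0" | "q > 0" by linarith
  then have "(cmod a)\<^sup>2 \<le> p * q"
  proof cases
    case 1
    have "cmod a = 0"
    proof (rule ccontr)
      assume "cmod a \<noteq> 0"
      then show False
        \<comment> \<open>For q = 0 the bound is affine in t, and this t gives it the value
          -1.\<close>
        using quad[of "(p + 1) / (2 * (cmod a)\<^sup>2)"] quad[of 0] 1 by simp
    qed
    then show ?thesis
      using 1 by simp
  next
    case 2
    then show ?thesis
      \<comment> \<open>The minimizer of the quadratic when a is nonzero; its value there is p -
        |a|^2 / q.\<close>
      using quad[of "1 / q"] by (simp add: field_simps power2_eq_square)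
  qed
  then show ?thesis
    by (simp add: a_def p_def q_def)
qed

section \<open>Purity of a density matrix and its deviations from uniformity in unbiased
  bases\<close>

context
  fixes \<rho> :: "'a::fin_dim_hilbert \<Rightarrow> 'a"
  assumes \<rho>: "density_matrix \<rho>"
begin

lemma density_matrix_psd: "positive_semidefinite \<rho>"
  using \<rho> by (simp add: density_matrix_def)

lemma density_matrix_linear: "Vector_Spaces.linear scaleC scaleC \<rho>"
  using density_matrix_psd by (simp add: positive_semidefinite_def)

lemma density_matrix_trace:
  assumes "orthonormal_basis E"
  shows "(\<Sum>e\<in>E. cinner e (\<rho> e)) = 1"
  using \<rho> trace_op_eq[OF density_matrix_linear assms] by (simp add: density_matrix_def)

lemma density_matrix_probabilities:
  shows "0 \<le> Re (cinner b (\<rho> b))"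
    and "orthonormal_basis E \<Longrightarrow> (\<Sum>e\<in>E. Re (cinner e (\<rho> e))) = 1"
  using psd_Re_ge_0[OF density_matrix_psd] density_matrix_trace by (simp_all flip: Re_sum)

text \<open>In dimension 0 the basis is empty and the trace would be 0 instead of 1.\<close>

lemma density_matrix_dim_pos:
  fixes E :: "'a set"
  assumes E: "orthonormal_basis E"
  shows "0 < complex_vector.dim (UNIV :: 'a set)"
  using density_matrix_trace[OF E] orthonormal_basis_finite_card[OF E]
  by (metis card_gt_0_iff sum.empty zero_neq_one)

text \<open>Self-adjointness turns the purity into a squared Hilbert-Schmidt norm.\<close>

lemma purity_eq:
  fixes E :: "'a set"
  assumes E: "orthonormal_basis E"
  shows "trace_op (\<rho> \<circ> \<rho>) = (\<Sum>e\<in>E. cinner (\<rho> e) (\<rho> e))"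
proof -
  have "Vector_Spaces.linear scaleC scaleC (\<rho> \<circ> \<rho>)"
    using Vector_Spaces.linear_compose density_matrix_linear by blast
  then show ?thesis
    using trace_op_eq[OF _ E] by (simp add: psd_hermitian[OF density_matrix_psd])
qed

text \<open>Cauchy-Schwarz bounds each squared matrix entry by a product of two diagonal entries,
  and the double sum of these products is the squared trace.\<close>

lemma purity_le_1:
  fixes E :: "'a set"
  assumes E: "orthonormal_basis E"
  shows "Re (trace_op (\<rho> \<circ> \<rho>)) \<le> 1"
proof -
  have "cinner (\<rho> e) (\<rho> e) = of_real (\<Sum>f\<in>E. (cmod (cinner f (\<rho> e)))\<^sup>2)" for e
  proof -
    have "(\<Sum>f\<in>E. cinner f (\<rho> e) * cinner (\<rho> e) (id f)) = cinner (\<rho> e) (id (\<rho> e))"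
      by (rule onb_cinner_linear[OF E complex_vector.linear_id])
    moreover have "cinner f (\<rho> e) * cinner (\<rho> e) f = of_real ((cmod (cinner f (\<rho> e)))\<^sup>2)" for f
      by (subst (2) cinner_commute) (rule complex_norm_square[symmetric])
    ultimately show ?thesis
      by simp
  qed
  then have "Re (trace_op (\<rho> \<circ> \<rho>)) = (\<Sum>e\<in>E. \<Sum>f\<in>E. (cmod (cinner f (\<rho> e)))\<^sup>2)"
    using purity_eq[OF E] by simp
  also have "\<dots> \<le> (\<Sum>e\<in>E. \<Sum>f\<in>E. Re (cinner f (\<rho> f)) * Re (cinner e (\<rho> e)))"
    by (intro sum_mono psd_Cauchy_Schwarz density_matrix_psd)
  also have "\<dots> = (\<Sum>f\<in>E. Re (cinner f (\<rho> f))) * (\<Sum>e\<in>E. Re (cinner e (\<rho> e)))"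
    by (subst sum.swap) (rule sum_product[symmetric])
  finally show ?thesis
    using density_matrix_probabilities(2)[OF E] by simp
qed

text \<open>Bessel's inequality: the operator \<open>S\<close> below is the Hilbert--Schmidt projection of
  \<open>\<tau> = \<rho> - 1/d\<close> onto the traceless operators spanned by the projectors onto the basis vectors.
  Unbiasedness makes the traceless operators diagonal in different bases orthogonal.\<close>

lemma MUBs_deviation_le:
  assumes dim: "complex_vector.dim (UNIV :: 'a set) = d"
    and mub: "MUBs \<BB>" and E: "E \<in> \<BB>" and fin: "finite \<BB>"
  shows "(\<Sum>B\<in>\<BB>. \<Sum>b\<in>B. (Re (cinner b (\<rho> b)) - 1 / d)\<^sup>2) \<le> Re (trace_op (\<rho> \<circ> \<rho>)) - 1 / d"
proof -
  interpret \<rho>: Vector_Spaces.linear scaleC scaleC \<rho> by (rule density_matrix_linear)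
  have onb: "orthonormal_basis B" if "B \<in> \<BB>" for B
    using mub that by (simp add: MUBs_def)
  note onbE = onb[OF E]
  have card: "finite B" "card B = d" if "B \<in> \<BB>" for B
    using orthonormal_basis_finite_card[OF onb[OF that]] dim by auto
  have d: "d > 0"
    using density_matrix_dim_pos[OF onbE] dim by simp
  define q where "q b = Re (cinner b (\<rho> b)) - 1 / d" for b
  define \<tau> where "\<tau> x = \<rho> x - of_real (1 / d) *\<^sub>C x" for x
  define S where "S x = (\<Sum>B\<in>\<BB>. \<Sum>b\<in>B. (of_real (q b) * cinner b x) *\<^sub>C b)" for x
  have q0: "(\<Sum>b\<in>B. q b) = 0" if "B \<in> \<BB>" for B
    using density_matrix_probabilities(2)[OF onb[OF that]] card[OF that] d
    by (simp add: q_def sum_subtractf)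
  have \<tau>_lin: "Vector_Spaces.linear scaleC scaleC \<tau>"
    by unfold_locales (simp_all add: \<tau>_def \<rho>.add \<rho>.scale complex_vector.scale_right_distrib
        complex_vector.scale_right_diff_distrib mult.commute)
  have S_lin: "Vector_Spaces.linear scaleC scaleC S"
    by unfold_locales (simp_all add: S_def cinner_add_right cinner_scaleC_right distrib_left
        complex_vector.scale_left_distrib sum.distrib complex_vector.scale_sum_right mult_ac)
  \<comment> \<open>Hilbert-Schmidt product of \<open>S\<close> with \<open>A\<close>: each
    projector |b><b| in \<open>S\<close> picks out the diagonal entry of \<open>A\<close> at
    \<open>b\<close>.\<close>
  have S_inner: "(\<Sum>e\<in>E. cinner (S e) (A e)) = (\<Sum>B\<in>\<BB>. \<Sum>b\<in>B. of_real (q b) * cinner b (A b))"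
    if A: "Vector_Spaces.linear scaleC scaleC A" for A
  proof -
    have "(\<Sum>e\<in>E. cinner (S e) (A e))
        = (\<Sum>e\<in>E. \<Sum>B\<in>\<BB>. \<Sum>b\<in>B. of_real (q b) * (cinner e b * cinner b (A e)))"
      by (simp add: S_def cinner_sum_left cinner_scaleC_left mult.assoc flip: cinner_commute)
    also have "\<dots> = (\<Sum>B\<in>\<BB>. \<Sum>b\<in>B. of_real (q b) * (\<Sum>e\<in>E. cinner e b * cinner b (A e)))"
      unfolding sum_distrib_left
      by (subst sum.swap[of _ \<BB> E], rule sum.cong[OF refl], rule sum.swap)
    also have "\<dots> = (\<Sum>B\<in>\<BB>. \<Sum>b\<in>B. of_real (q b) * cinner b (A b))"
      by (simp add: onb_cinner_linear[OF onbE A])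
    finally show ?thesis .
  qed
  have b\<tau>: "Re (cinner b (\<tau> b)) = q b" if "B \<in> \<BB>" "b \<in> B" for B b
    using onb[OF that(1)] that(2)
    by (simp add: \<tau>_def q_def cinner_diff_right cinner_scaleC_right orthonormal_basis_def)
  \<comment> \<open>\<open>S\<close> and \<open>\<tau>\<close> have the same diagonal in every basis
    of the family, hence <S, \<tau>> = <S, S>: this is the projection property.\<close>
  have bS: "Re (cinner b (S b)) = q b" if B: "B \<in> \<BB>" "b \<in> B" for B b
  proof -
    have cn: "cinner b c * cinner c b = of_real ((cmod (cinner b c))\<^sup>2)" for c
      by (subst (2) cinner_commute) (rule complex_norm_square[symmetric])
    have "cinner b (S b) = (\<Sum>C\<in>\<BB>. \<Sum>c\<in>C. of_real (q c) * (cinner b c * cinner c b))"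
      by (simp add: S_def cinner_sum_right cinner_scaleC_right mult_ac)
    then have "Re (cinner b (S b)) = (\<Sum>C\<in>\<BB>. \<Sum>c\<in>C. q c * (cmod (cinner b c))\<^sup>2)"
      by (simp add: cn)
    also have "\<dots> = (\<Sum>C\<in>\<BB>. if C = B then q b else 0)"
    proof (intro sum.cong refl)
      fix C assume C: "C \<in> \<BB>"
      show "(\<Sum>c\<in>C. q c * (cmod (cinner b c))\<^sup>2) = (if C = B then q b else 0)"
      proof (cases "C = B")
        case True
        have "(\<Sum>c\<in>B. q c * (cmod (cinner b c))\<^sup>2) = (\<Sum>c\<in>B. if b = c then q c else 0)"
          using onb[OF B(1)] B(2) by (intro sum.cong) (auto simp: orthonormal_basis_def)
        then show ?thesis
          using True B card by simp
      next
        case False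
        \<comment> \<open>Unbiasedness makes the weights constant, and the deviations
          \<open>q\<close> sum to 0 over \<open>C\<close>.\<close>
        have "(\<Sum>c\<in>C. q c * (cmod (cinner b c))\<^sup>2) = (\<Sum>c\<in>C. q c * (1 / d))"
          using mub B C False dim
          by (intro sum.cong) (auto simp: MUBs_def mutually_unbiased_def power_divide)
        also have "\<dots> = 0"
          using q0[OF C] by (simp flip: sum_divide_distrib)
        finally show ?thesis
          using False by simp
      qed
    qed
    also have "\<dots> = q b"
      using B fin by simp
    finally show ?thesis .
  qed
  have S\<tau>: "Re (\<Sum>e\<in>E. cinner (S e) (\<tau> e)) = (\<Sum>B\<in>\<BB>. \<Sum>b\<in>B. (q b)\<^sup>2)"
    unfolding S_inner[OF \<tau>_lin] by (simp add: b\<tau> power2_eq_square)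
  have SS: "Re (\<Sum>e\<in>E. cinner (S e) (S e)) = (\<Sum>B\<in>\<BB>. \<Sum>b\<in>B. (q b)\<^sup>2)"
    unfolding S_inner[OF S_lin] by (simp add: bS power2_eq_square)
  have \<tau>\<tau>: "Re (\<Sum>e\<in>E. cinner (\<tau> e) (\<tau> e)) = Re (trace_op (\<rho> \<circ> \<rho>)) - 1 / d"
  proof -
    have "Re (cinner (\<tau> e) (\<tau> e)) = Re (cinner (\<rho> e) (\<rho> e)) - 2 / d * Re (cinner e (\<rho> e)) + (1 / d)\<^sup>2"
      if "e \<in> E" for e
      using onbE that Re_cinner_commute[of "\<rho> e" e]
      by (simp add: \<tau>_def cinner_diff_right cinner_diff_left cinner_scaleC_right cinner_scaleC_left
          orthonormal_basis_def algebra_simps power2_eq_square)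
    then have "Re (\<Sum>e\<in>E. cinner (\<tau> e) (\<tau> e))
        = Re (trace_op (\<rho> \<circ> \<rho>)) - 2 / d * (\<Sum>e\<in>E. Re (cinner e (\<rho> e))) + card E * (1 / d)\<^sup>2"
      by (simp add: purity_eq[OF onbE] sum.distrib sum_subtractf sum_distrib_left)
    then show ?thesis
      using card[OF E] d density_matrix_probabilities(2)[OF onbE] by (simp add: power2_eq_square)
  qed
  \<comment> \<open>The squared norm of \<tau> - S equals that of \<tau> minus the sum of all
    squared deviations.\<close>
  have "0 \<le> (\<Sum>e\<in>E. Re (cinner (\<tau> e - S e) (\<tau> e - S e)))"
    by (intro sum_nonneg Re_cinner_ge_0)
  also have "\<dots> = Re (\<Sum>e\<in>E. cinner (\<tau> e) (\<tau> e)) - 2 * Re (\<Sum>e\<in>E. cinner (S e) (\<tau> e))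
      + Re (\<Sum>e\<in>E. cinner (S e) (S e))"
    using Re_cinner_commute[of "\<tau> _" "S _"]
    by (simp add: cinner_diff_left cinner_diff_right sum.distrib sum_subtractf sum_distrib_left)
  finally show ?thesis
    using S\<tau> SS \<tau>\<tau> by (simp add: q_def)
qed

end

section \<open>Combination of the tangent bound with the Bessel estimate\<close>

theorem proposition1:
  fixes \<BB> :: "'h::fin_dim_hilbert set set"
    and \<rho> :: "'h \<Rightarrow> 'h"
    and \<alpha> :: real
    and d M :: nat
  assumes "complex_vector.dim (UNIV :: 'h set) = d"
    and "finite \<BB>" and "card \<BB> = M" and "M \<ge> 1"
    and "MUBs \<BB>"
    and "0 < \<alpha>" and "\<alpha> \<le> 2"
    and "density_matrix \<rho>"
  shows "1 / real M * (\<Sum>B\<in>\<BB>. basis_entropy \<alpha> B \<rho>)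
           \<ge> ln_tsallis \<alpha> (real M * real d / (Re (trace_op (\<rho> \<circ> \<rho>)) * real d + real M - 1))
       \<and> 1 / real M * (\<Sum>B\<in>\<BB>. basis_entropy \<alpha> B \<rho>)
           \<ge> ln_tsallis \<alpha> (real M * real d / (real d + real M - 1))"
proof -
  obtain B where B: "B \<in> \<BB>"
    using assms by fastforce
  have onb: "orthonormal_basis C" if "C \<in> \<BB>" for C
    using assms that by (auto simp: MUBs_def)
  have d: "d > 0"
    using density_matrix_dim_pos[OF \<open>density_matrix \<rho>\<close> onb[OF B]] assms by simp
  define p where "p b = Re (cinner b (\<rho> b))" for b
  define T where "T = Re (trace_op (\<rho> \<circ> \<rho>))"
  have p: "\<And>b. 0 \<le> p b" "\<And>C. C \<in> \<BB> \<Longrightarrow> (\<Sum>b\<in>C. p b) = 1"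
    using density_matrix_probabilities[OF \<open>density_matrix \<rho>\<close>] onb by (auto simp: p_def)
  have fin: "finite C" and card: "card C = d" if "C \<in> \<BB>" for C
    using orthonormal_basis_finite_card[OF onb[OF that]] assms by auto
  have dev: "(\<Sum>C\<in>\<BB>. \<Sum>b\<in>C. (p b - 1 / d)\<^sup>2) \<le> T - 1 / d"
    unfolding p_def T_def using MUBs_deviation_le[OF assms(8,1,5) B assms(2)] .
  \<comment> \<open>The deviations are squares, so their upper bound is nonnegative. This later
    keeps the denominators positive.\<close>
  have T: "1 / d \<le> T"
    using dev by (smt (verit) sum_nonneg zero_le_power2)
  have T1: "T \<le> 1"
    unfolding T_def using purity_le_1[OF \<open>density_matrix \<rho>\<close> onb[OF B]] .
  have "(\<Sum>b\<in>C. (p b - 1 / d)\<^sup>2) = (\<Sum>b\<in>C. (p b)\<^sup>2) - 1 / d" if "C \<in> \<BB>" for C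
  proof -
    have "(\<Sum>b\<in>C. (p b - 1 / d)\<^sup>2) = (\<Sum>b\<in>C. (p b)\<^sup>2) - 2 / d * (\<Sum>b\<in>C. p b) + card C * (1 / d)\<^sup>2"
      unfolding sum_distrib_left
      by (simp add: power2_diff sum.distrib sum_subtractf mult_ac)
    then show ?thesis
      using p(2)[OF that] card[OF that] d by (simp add: power2_eq_square)
  qed
  \<comment> \<open>Each of the M bases contributes 1/d on passing from deviations to collision
    probabilities, against the single -1/d in \<open>dev\<close>.\<close>
  then have C: "(\<Sum>C\<in>\<BB>. \<Sum>b\<in>C. (p b)\<^sup>2) \<le> T + (real M - 1) / d"
    using dev assms(3) by (simp add: sum_subtractf diff_divide_distrib)
  \<comment> \<open>Any upper bound t of the purity serves: t = T gives the state-dependent bound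
    and t = 1 the other, without monotonicity of \<open>ln_tsallis\<close>.\<close>
  have main: "1 / real M * (\<Sum>B\<in>\<BB>. basis_entropy \<alpha> B \<rho>) \<ge> ln_tsallis \<alpha> (real M * real d / (t * real d + real M - 1))"
    if t: "T \<le> t" for t
  proof -
    have "0 < t * d + real M - 1"
    proof -
      have "1 / d * d \<le> t * d"
        using T t by (intro mult_right_mono) auto
      then show ?thesis
        using d \<open>M \<ge> 1\<close> by simp
    qed
    \<comment> \<open>The tangent point is (t + (M - 1) / d) / M, the bound on the mean collision
      probability.\<close>
    then have pos: "0 < (t * d + real M - 1) / (real M * d)"
      using d \<open>M \<ge> 1\<close> by simp
    have "T + (real M - 1) / d \<le> t + (real M - 1) / d"
      using t by simp
    also have "\<dots> = real (card \<BB>) * ((t * d + real M - 1) / (real M * d))"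
      using d assms by (simp add: field_simps)
    finally have "(\<Sum>C\<in>\<BB>. \<Sum>b\<in>C. (p b)\<^sup>2) \<le> real (card \<BB>) * ((t * d + real M - 1) / (real M * d))"
      using C by linarith
    from sum_tsallis_entropy_ge[OF \<open>0 < \<alpha>\<close> \<open>\<alpha> \<le> 2\<close> pos p this]
    have "real M * ln_tsallis \<alpha> (real M * real d / (t * real d + real M - 1)) \<le> (\<Sum>B\<in>\<BB>. basis_entropy \<alpha> B \<rho>)"
      by (simp add: basis_entropy_def p_def[abs_def] assms)
    then show ?thesis
      using \<open>M \<ge> 1\<close> by (simp add: field_simps)
  qed
  show ?thesis
    using main[of T] main[of 1] T1 by (simp add: T_def)
qed

end
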